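(* Let $n \ge 5$ be an integer. Let $\mathcal{N}_{\max}$ be the maximum nullity among all connected quartic circulant graphs of order $n$, i.e. among the connected graphs $\mathrm{Circ}(n, \{p, q\})$ with integers $1 \le p < q < \frac{n}{2}$. Then the following hold, where "attains" refers to connected quartic circulant graphs of order $n$ having nullity $\mathcal{N}_{\max}$. (1) If $n$ is odd, then $\mathcal{N}_{\max} = 0$; the graphs $\mathrm{Circ}(n, \{p, q\})$, $1 \le p < q < \frac{n}{2}$, attaining it are exactly those with $\gcd(p, q, n) = 1$, and the corresponding null spaces are trivial. (2) If $n \ge 6$, $2 \mid n$ and $8 \nmid n$, then $\mathcal{N}_{\max} = \frac{n}{2}$; the graphs $\mathrm{Circ}(n, \{p, q\})$, $1 \le p < q < \frac{n}{2}$, attaining it are exactly those with $p + q = \frac{n}{2}$ and $\gcd(p, q, n) = 1$, and the null space of each such graph is \[ \left\{ (v_0, v_1, \ldots, v_{n-1})^{\mathrm T} \in \mathbb{R}^n \colon v_{j + \frac{n}{2}} = -v_j \ \text{ for all } 0 \le j \le \tfrac{n}{2}-1 \right\}. \] (3) If $n \ge 8$ and $8 \mid n$, then $\mathcal{N}_{\max} = \frac{n}{2} + 2$; the graphs $\mathrm{Circ}(n, \{p, q\})$, $1 \le p < q < \frac{n}{2}$, attaining it are exactly those with $p + q = \frac{n}{2}$ and $\gcd(p, q, n) = 1$, and the null space of each such graph is \[ \mathrm{span} \left( e_0 - e_{\frac{n}{2}},\ e_1 - e_{\frac{n}{2} + 1},\ \ldots,\ e_{\frac{n}{2} - 1} -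 e_{n-1},\ \sum_{j = 0}^{\frac{n}{4}-1} (-1)^j \, e_{\frac{n}{2} + 2j},\ \sum_{j = 0}^{\frac{n}{4}-1} (-1)^j \, e_{\frac{n}{2} + 2j+1} \right), \] where $e_j \in \mathbb{R}^n$ ($0 \le j \le n-1$) is the vector whose entry with index $j$ equals one and whose other entries are zero.
   Context: For an integer $n \ge 1$ and a set $S$ of integers $j$ with $1 \le j \le \frac{n}{2}$, $\mathrm{Circ}(n, S)$ denotes the circulant graph with vertex set $\{0, 1, \ldots, n-1\}$ in which two distinct vertices $i, k$ are adjacent if and only if $i - k \equiv s$ or $i - k \equiv -s \pmod n$ for some $s \in S$. The quartic ($4$-regular) circulant graphs of order $n$ are exactly the graphs $\mathrm{Circ}(n, \{p, q\})$ with $n \ge 5$ and $1 \le p < q < \frac{n}{2}$. The null space of a graph is the null space of its adjacency matrix (as a subspace of $\mathbb{R}^n$, coordinates indexed by the vertices $0, 1, \ldots, n-1$ in order), and its nullity is the dimension of this null space. *)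

theory Defs
  imports
    "HOL-Number_Theory.Cong"
    "Jordan_Normal_Form.Matrix_Kernel"
    "Graph_Theory.Digraph_Component"
begin

text \<open>
  An undirected simple graph is represented as a symmetric loop-free digraph: each edge
  \<open>{i, k}\<close> is the pair of arcs \<open>(i, k)\<close> and \<open>(k, i)\<close>.
\<close>

definition circ :: "nat \<Rightarrow> nat set \<Rightarrow> nat pair_pre_digraph" where
  "circ n S = \<lparr>
     pverts = {0..<n},
     parcs = {(i, k). i < n \<and> k < n \<and> i \<noteq> k \<and>
       (\<exists>s\<in>S. [int i - int k = int s] (mod int n) \<or> [int i - int k = - int s] (mod int n))}\<rparr>"

lemma pair_graph_circ: "pair_graph (circ n S)"
proof -
  have *: "[int k - int i = t] (mod int n) \<longleftrightarrow> [int i - int k = - t] (mod int n)" for i k t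
    using cong_minus_minus_iff[of "int k - int i" t "int n"] by simp
  have fin: "finite (parcs (circ n S))"
    by (rule finite_subset[of _ "{0..<n} \<times> {0..<n}"]) (auto simp: circ_def)
  have "sym (parcs (circ n S))"
    unfolding sym_def circ_def using * by fastforce
  then show ?thesis
    using fin by unfold_locales (auto simp: circ_def symmetric_def)
qed

text \<open>Adjacency matrix and its null space, for graphs with vertex set \<open>{0..<n}\<close>.\<close>

definition adj_mat :: "nat pair_pre_digraph \<Rightarrow> real mat" where
  "adj_mat G = mat (card (pverts G)) (card (pverts G))
     (\<lambda>(i, k). if (i, k) \<in> parcs G then 1 else 0)"

definition null_space :: "nat pair_pre_digraph \<Rightarrow> real vec set" where
  "null_space G = mat_kernel (adj_mat G)"

definition nullity :: "nat pair_pre_digraph \<Rightarrow> nat" where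
  "nullity G = kernel_dim (adj_mat G)"

definition conn_quartic_circ :: "nat \<Rightarrow> nat pair_pre_digraph set" where
  "conn_quartic_circ n =
     {circ n {p, q} | p q. 1 \<le> p \<and> p < q \<and> 2 * q < n \<and>
        Digraph_Component.connected (with_proj (circ n {p, q}))}"

definition max_nullity :: "nat \<Rightarrow> nat" where
  "max_nullity n = Max (nullity ` conn_quartic_circ n)"

definition attains_max :: "nat \<Rightarrow> nat pair_pre_digraph \<Rightarrow> bool" where
  "attains_max n G \<longleftrightarrow> G \<in> conn_quartic_circ n \<and> nullity G = max_nullity n"

text \<open>\<open>Max\<close> is only meaningful on finite nonempty sets; nonemptiness for \<open>5 \<le> n\<close> is
  witnessed by \<open>p = 1\<close>, \<open>q = 2\<close>.\<close>

lemma finite_conn_quartic_circ: "finite (conn_quartic_circ n)"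
  by (rule finite_subset[of _ "(\<lambda>(p, q). circ n {p, q}) ` ({0..<n} \<times> {0..<n})"])
    (force simp: conn_quartic_circ_def)+

abbreviation span_vec :: "nat \<Rightarrow> real vec set \<Rightarrow> real vec set" where
  "span_vec n \<equiv> LinearCombinations.module.span class_ring (module_vec TYPE(real) n)"

end

theory Submission
  imports Defs "Jordan_Normal_Form.DL_Rank"
begin

text \<open>
  Read a vector as an \<open>n\<close>-periodic function on the integers and let \<open>S\<close> be the shift. The adjacency
  operator of \<open>Circ(n, {p, q})\<close> factors as
  \<open>S\<^sup>-\<^sup>q (S\<^sup>p\<^sup>+\<^sup>q + 1) (S\<^sup>q\<^sup>-\<^sup>p + 1)\<close>, so no eigenvalues are needed.
  An \<open>n\<close>-periodic function in the kernel of \<open>S\<^sup>a + 1\<close> is determined by its first \<open>gcd(a, n)\<close>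
  values, and vanishes if \<open>n / gcd(a, n)\<close> is odd. Hence the nullity is at most
  \<open>gcd(p + q, n) + gcd(q - p, n)\<close>, where a summand whose cofactor in \<open>n\<close> is odd is dropped.
  For \<open>n = 2 m\<close> and \<open>p + q \<noteq> m\<close> each remaining summand is at most \<open>m / 2\<close>, and both
  attain this only if \<open>m / 2\<close> divides \<open>2\<close>, which is impossible; so the nullity is below \<open>m\<close>.
  If \<open>p + q = m\<close>, then \<open>w\<close> lies in the null space iff \<open>s = w + S\<^sup>m w\<close>, which is
  \<open>m\<close>-periodic, satisfies \<open>S\<^sup>q\<^sup>-\<^sup>p s = - s\<close>. As \<open>p\<close> is coprime to \<open>m\<close>, this forces
  \<open>s = 0\<close> unless \<open>4\<close> divides \<open>m\<close>, in which case it amounts to \<open>S\<^sup>2 s = - s\<close>.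
\<close>

section \<open>Bounding the kernel of a matrix by linear functionals\<close>

text \<open>A basis of the smaller kernel stays independent in the larger one:
  \<open>lindep_same\<close> reduces dependence in either kernel to dependence in the ambient
  space.\<close>

lemma kernel_dim_mono:
  fixes A F :: "'a :: field mat"
  assumes A: "A \<in> carrier_mat nr nc" and F: "F \<in> carrier_mat k nc"
    and sub: "mat_kernel F \<subseteq> mat_kernel A"
  shows "kernel_dim F \<le> kernel_dim A"
proof -
  interpret A: kernel nr nc A by unfold_locales (rule A)
  interpret F: kernel k nc F by unfold_locales (rule F)
  obtain B where B: "finite B" "F.basis B" using kernel_basis_exists[OF F] by auto
  obtain C where C: "finite C" "A.basis C" using kernel_basis_exists[OF A] by auto
  have BF: "B \<subseteq> mat_kernel F" "\<not> F.lin_dep B" using B(2) by (auto simp: F.Ker.basis_def)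
  hence BA: "B \<subseteq> mat_kernel A" using sub by auto
  have "\<not> A.lin_dep B" using BF A.lindep_same[OF BA] F.lindep_same[OF BF(1)] by simp
  moreover have "A.Ker.fin_dim" using C unfolding A.Ker.fin_dim_def A.Ker.basis_def by auto
  ultimately have "card B \<le> A.dim" using A.Ker.li_le_dim(2) BA by simp
  thus ?thesis using F.Ker.dim_basis[OF B] by simp
qed

text \<open>Rank-nullity: the echelon form of \<open>F\<close> has at most one pivot per row, hence
  at most \<open>k\<close>.\<close>

lemma kernel_dim_ge:
  fixes F :: "'a :: field mat"
  assumes F: "F \<in> carrier_mat k n"
  shows "n - k \<le> kernel_dim F"
proof -
  let ?B = "gauss_jordan_single F"
  note gj = gauss_jordan_single[OF F refl]
  have "length (pivot_positions ?B) = card {i. i < k \<and> row ?B i \<noteq> 0\<^sub>v n}"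
    by (rule find_base_vectors(5)[OF gj(3,2)])
  also have "\<dots> \<le> card {..<k}" by (rule card_mono) auto
  finally show ?thesis using F by (simp add: kernel_dim_code)
qed

text \<open>Let the columns of \<open>M\<close> be a kernel basis of size \<open>d\<close>. If
  \<open>d > k\<close>, then \<open>F * M\<close> kills some \<open>c \<noteq> 0\<close>, so
  \<open>M *\<^sub>v c\<close> lies in the kernel of \<open>A\<close> and is killed by
  \<open>F\<close>. It is therefore zero, against independence of the columns.\<close>

lemma kernel_dim_le:
  fixes A F :: "'a :: field mat"
  assumes A: "A \<in> carrier_mat nr n" and F: "F \<in> carrier_mat k n"
    and inj: "\<And>v. v \<in> mat_kernel A \<Longrightarrow> F *\<^sub>v v = 0\<^sub>v k \<Longrightarrow> v = 0\<^sub>v n"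
  shows "kernel_dim A \<le> k"
proof (rule ccontr)
  assume less: "\<not> kernel_dim A \<le> k"
  interpret A: kernel nr n A by unfold_locales (rule A)
  obtain B where B: "finite B" "A.basis B" using kernel_basis_exists[OF A] by auto
  obtain bs where bs: "set bs = B" "distinct bs" using finite_distinct_list[OF B(1)] by auto
  define d where "d = length bs"
  have d: "kernel_dim A = d" using A.Ker.dim_basis[OF B] bs by (simp add: d_def distinct_card[symmetric])
  have BA: "B \<subseteq> mat_kernel A" "\<not> A.lin_dep B" using B(2) by (auto simp: A.Ker.basis_def)
  hence Bc: "B \<subseteq> carrier_vec n" using mat_kernel_carrier[OF A] by blast
  define M where "M = mat_of_cols n bs"
  have M: "M \<in> carrier_mat n d" by (simp add: M_def d_def)
  have cM: "cols M = bs" using Bc bs by (simp add: M_def)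
  have FM: "F * M \<in> carrier_mat k d" using F M by simp
  interpret FM: kernel k d "F * M" by unfold_locales (rule FM)
  obtain C where C: "finite C" "FM.basis C" using kernel_basis_exists[OF FM] by auto
  have "card C > 0" using FM.Ker.dim_basis[OF C] kernel_dim_ge[OF FM] less d by simp
  then obtain c where "c \<in> C" by (auto simp: card_gt_0_iff)
  have "0\<^sub>v d \<notin> C" using FM.Ker.vs_zero_lin_dep[of C] C(2) by (auto simp: FM.Ker.basis_def)
  with \<open>c \<in> C\<close> have c: "c \<in> mat_kernel (F * M)" "c \<noteq> 0\<^sub>v d"
    using C(2) by (auto simp: FM.Ker.basis_def)
  note c' = mat_kernelD[OF FM c(1)]
  have AM: "A * M = 0\<^sub>m nr d"
  proof (rule eq_matI)
    fix i j assume ij: "i < dim_row (0\<^sub>m nr d)" "j < dim_col (0\<^sub>m nr d)"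
    have "col M j \<in> mat_kernel A" using BA ij cM bs d_def M
      by (metis carrier_matD(2) cols_nth index_zero_mat(3) nth_mem subsetD)
    hence "(A *\<^sub>v col M j) $ i = 0" using mat_kernelD[OF A] ij by simp
    thus "(A * M) $$ (i, j) = 0\<^sub>m nr d $$ (i, j)" using ij A M by simp
  qed (use A M in auto)
  have "M *\<^sub>v c \<in> mat_kernel A"
  proof (rule mat_kernelI[OF A])
    show "M *\<^sub>v c \<in> carrier_vec n" using M c' by simp
    have "A *\<^sub>v (M *\<^sub>v c) = (A * M) *\<^sub>v c" using assoc_mult_mat_vec[OF A M c'(1)] by simp
    also have "\<dots> = 0\<^sub>v nr" using c' AM by (auto intro!: eq_vecI)
    finally show "A *\<^sub>v (M *\<^sub>v c) = 0\<^sub>v nr" .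
  qed
  moreover have "F *\<^sub>v (M *\<^sub>v c) = 0\<^sub>v k" using assoc_mult_mat_vec[OF F M c'(1)] c'(2) by simp
  ultimately have "M *\<^sub>v c = 0\<^sub>v n" by (rule inj)
  hence "A.NC.lin_dep (set (cols M))"
    by (intro A.NC.lin_depI[OF M c'(1) c(2)]) (simp_all add: cM bs)
  thus False using BA A.lindep_same[OF BA(1)] by (simp add: cM bs)
qed

lemma mat_of_rows_mult_vec_eq_0:
  assumes "set rs \<subseteq> carrier_vec n"
  shows "mat_of_rows n rs *\<^sub>v v = 0\<^sub>v (length rs) \<longleftrightarrow> (\<forall>r\<in>set rs. r \<bullet> v = 0)"
proof -
  have "mat_of_rows n rs *\<^sub>v v = vec (length rs) (\<lambda>i. rs ! i \<bullet> v)"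
    using assms by (intro eq_vecI) (auto simp: mat_of_rows_row nth_mem subset_iff)
  thus ?thesis by (simp add: vec_eq_iff all_set_conv_all_nth)
qed

text \<open>For upper bounds on the nullity, with point evaluations and their sums as rows;
  \<open>kernel_dim_ge_functionals\<close> is the counterpart for lower bounds.\<close>

lemma kernel_dim_le_functionals:
  fixes A :: "'a :: field mat"
  assumes A: "A \<in> carrier_mat nr n" and rs: "set rs \<subseteq> carrier_vec n"
    and inj: "\<And>v. v \<in> mat_kernel A \<Longrightarrow> \<forall>r\<in>set rs. r \<bullet> v = 0 \<Longrightarrow> v = 0\<^sub>v n"
  shows "kernel_dim A \<le> length rs"
  by (rule kernel_dim_le[OF A mat_of_rows_carrier(1)])
    (simp add: inj mat_of_rows_mult_vec_eq_0[OF rs])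

lemma kernel_dim_ge_functionals:
  fixes A :: "'a :: field mat"
  assumes A: "A \<in> carrier_mat nr n" and rs: "set rs \<subseteq> carrier_vec n"
    and sub: "\<And>v. v \<in> carrier_vec n \<Longrightarrow> \<forall>r\<in>set rs. r \<bullet> v = 0 \<Longrightarrow> v \<in> mat_kernel A"
  shows "n - length rs \<le> kernel_dim A"
proof -
  have F: "mat_of_rows n rs \<in> carrier_mat (length rs) n" by simp
  have "mat_kernel (mat_of_rows n rs) \<subseteq> mat_kernel A"
    using sub by (auto simp: mat_kernel[OF F] mat_of_rows_mult_vec_eq_0[OF rs])
  from kernel_dim_ge[OF F] kernel_dim_mono[OF A F this] show ?thesis by linarith
qed

section \<open>Periodic functions on the integers\<close>

definition per :: "nat \<Rightarrow> real vec \<Rightarrow> int \<Rightarrow> real" where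
  "per n v x = v $ nat (x mod int n)"

lemma per_int: "i < n \<Longrightarrow> per n v (int i) = v $ i"
  by (simp add: per_def)

lemma per_add_period: "per n v (x + int n) = per n v x"
  by (simp add: per_def)

lemma vec_eq_0_iff_per:
  assumes "n > 0" "v \<in> carrier_vec n"
  shows "v = 0\<^sub>v n \<longleftrightarrow> (\<forall>x. per n v x = 0)"
proof
  assume z: "\<forall>x. per n v x = 0"
  show "v = 0\<^sub>v n"
  proof (rule eq_vecI)
    fix i assume "i < dim_vec (0\<^sub>v n :: real vec)"
    thus "v $ i = 0\<^sub>v n $ i" using z per_int[of i n v] by simp
  qed (use assms in simp)
qed (use assms in \<open>simp add: per_def nat_less_iff\<close>)

text \<open>The dimension bounds take functionals as row vectors; this row evaluates
  \<open>per n v\<close> at \<open>x\<close>.\<close>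

definition eval_vec :: "nat \<Rightarrow> int \<Rightarrow> real vec" where
  "eval_vec n x = unit_vec n (nat (x mod int n))"

lemma eval_vec_carrier [simp]: "eval_vec n x \<in> carrier_vec n"
  by (simp add: eval_vec_def)

lemma eval_vec_scalar_prod:
  assumes "n > 0" "v \<in> carrier_vec n"
  shows "eval_vec n x \<bullet> v = per n v x"
  using assms by (simp add: per_def eval_vec_def nat_less_iff)

lemma eval_vec_add_scalar_prod:
  assumes "n > 0" "v \<in> carrier_vec n"
  shows "(eval_vec n x + eval_vec n y) \<bullet> v = per n v x + per n v y"
  using assms by (simp add: add_scalar_prod_distrib[of _ n] eval_vec_scalar_prod)

section \<open>Functions on the integers with a period and an antiperiod\<close>

lemma shift_multiple:
  fixes w :: "int \<Rightarrow> real"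
  assumes "\<And>x. w (x + a) = - w x"
  shows "w (x + k * a) = (if even k then w x else - w x)"
proof (induction k rule: int_induct[where k = 0])
  case (step1 k)
  have "w (x + (k + 1) * a) = - w (x + k * a)"
    using assms[of "x + k * a"] by (simp add: algebra_simps)
  with step1 show ?case by auto
next
  case (step2 k)
  have "w (x + k * a) = - w (x + (k - 1) * a)"
    using assms[of "x + (k - 1) * a"] by (simp add: algebra_simps)
  with step2 show ?case by auto
qed simp

lemma period_multiple:
  fixes w :: "int \<Rightarrow> real"
  assumes "\<And>x. w (x + n) = w x"
  shows "w (x + k * n) = w x"
proof (induction k rule: int_induct[where k = 0])
  case (step1 k)
  then show ?case using assms[of "x + k * n"] by (simp add: algebra_simps)
next
  case (step2 k)
  then show ?case using assms[of "x + (k - 1) * n"] by (simp add: algebra_simps)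
qed simp

text \<open>The dimension of the space of \<open>n\<close>-periodic functions \<open>w\<close> with \<open>w (x + a) = - w x\<close>.\<close>

definition antiperiod_dim :: "nat \<Rightarrow> nat \<Rightarrow> nat" where
  "antiperiod_dim n a = (if even (n div gcd a n) then gcd a n else 0)"

text \<open>By Bezout, \<open>d = gcd a n\<close> is an integer combination of \<open>a\<close> and
  \<open>n\<close>, so shifting by \<open>d\<close> changes \<open>w\<close> at most by a sign and
  the first \<open>d\<close> values decide.\<close>

lemma antiperiodic_eq_0:
  fixes w :: "int \<Rightarrow> real"
  assumes n: "n > 0" and per: "\<And>x. w (x + int n) = w x"
    and anti: "\<And>x. w (x + int a) = - w x"
    and zero: "\<And>i. i < antiperiod_dim n a \<Longrightarrow> w (int i) = 0"
  shows "w x = 0"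
proof -
  define d where "d = gcd a n"
  have d: "d > 0" using n by (simp add: d_def)
  have shift: "\<bar>w (x + int d * k)\<bar> = \<bar>w x\<bar>" for x k
  proof -
    obtain u v where uv: "u * int a + v * int n = int d"
      using bezout_int[of "int a" "int n"] by (auto simp: d_def)
    have "x + int d * k = (x + (k * u) * int a) + (k * v) * int n"
      by (simp add: uv[symmetric] algebra_simps)
    hence "w (x + int d * k) = w (x + (k * u) * int a)"
      using period_multiple[of w "int n", OF per] by metis
    thus ?thesis using shift_multiple[of w "int a", OF anti] by simp
  qed
  show ?thesis
  proof (cases "even (n div d)")
    case True
    have "\<bar>w x\<bar> = \<bar>w (x mod int d)\<bar>"
      using shift[of "x mod int d" "x div int d"] by simp
    moreover have "w (int (nat (x mod int d))) = 0"
      using True d by (intro zero) (auto simp: antiperiod_dim_def d_def[symmetric] nat_less_iff)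
    ultimately show ?thesis using d by simp
  next
    case False
    \<comment> \<open>Both sides are \<open>a * n / d\<close>: an odd multiple of the antiperiod
      that is also a multiple of the period.\<close>
    have "int (n div d) * int a = int (a div d) * int n"
      by (metis d_def div_mult_swap dvd_div_mult gcd_dvd1 gcd_dvd2 mult.commute of_nat_mult)
    hence "w (x + int (n div d) * int a) = w x"
      using period_multiple[of w "int n", OF per] by simp
    moreover have "w (x + int (n div d) * int a) = - w x"
      using shift_multiple[of w "int a", OF anti] False by simp
    ultimately show ?thesis by simp
  qed
qed

section \<open>The null space of a quartic circulant graph\<close>

lemma circ_adjacent:
  assumes "i < n" "k < n" "1 \<le> p" "p < q" "2 * q < n"
  shows "(i, k) \<in> parcs (circ n {p, q}) \<longleftrightarrow>
    k \<in> (\<lambda>t. nat ((int i + t) mod int n)) ` {int p, - int p, int q, - int q}"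
proof -
  have *: "[int i - int k = t] (mod int n) \<longleftrightarrow> k = nat ((int i - t) mod int n)" for t
  proof -
    have "[int i - int k = t] (mod int n) \<longleftrightarrow> [int k = int i - t] (mod int n)"
      by (simp add: cong_iff_dvd_diff) (metis dvd_minus_iff minus_diff_eq diff_diff_eq2 add.commute diff_diff_eq)
    also have "\<dots> \<longleftrightarrow> int k = (int i - t) mod int n" using assms by (simp add: cong_def)
    also have "\<dots> \<longleftrightarrow> k = nat ((int i - t) mod int n)" using assms by auto
    finally show ?thesis .
  qed
  \<comment> \<open>Makes the loop-freeness condition in \<open>circ\<close> automatic, since
    \<open>p\<close> and \<open>q\<close> lie strictly between \<open>0\<close> and
    \<open>n\<close>.\<close>
  have ne: "i \<noteq> k" if "[int i - int k = t] (mod int n)" "0 < \<bar>t\<bar>" "\<bar>t\<bar> < int n" for t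
    using that zdvd_not_zless[of "\<bar>t\<bar>" "int n"] by (auto simp: cong_iff_dvd_diff)
  have "i \<noteq> k" if "t \<in> {int p, - int p, int q, - int q}" "[int i - int k = t] (mod int n)" for t
    using ne[OF that(2)] that(1) assms by auto
  hence "(i, k) \<in> parcs (circ n {p, q}) \<longleftrightarrow>
    (\<exists>t \<in> {int p, - int p, int q, - int q}. [int i - int k = t] (mod int n))"
    using assms(1,2) unfolding circ_def by auto
  also have "\<dots> \<longleftrightarrow> (\<exists>t \<in> {int p, - int p, int q, - int q}. k = nat ((int i - t) mod int n))"
    by (simp only: *)
  finally show ?thesis by auto
qed

lemma adj_mat_circ_carrier: "adj_mat (circ n S) \<in> carrier_mat n n"
  by (simp add: adj_mat_def circ_def)

lemma adj_mat_circ_mult_vec: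
  assumes "i < n" "1 \<le> p" "p < q" "2 * q < n" "v \<in> carrier_vec n"
  shows "(adj_mat (circ n {p, q}) *\<^sub>v v) $ i =
    per n v (int i + int p) + per n v (int i - int p) + per n v (int i + int q) + per n v (int i - int q)"
proof -
  let ?T = "{int p, - int p, int q, - int q}"
  let ?f = "\<lambda>t. nat ((int i + t) mod int n)"
  have "card (pverts (circ n {p, q})) = n" by (simp add: circ_def)
  hence "(adj_mat (circ n {p, q}) *\<^sub>v v) $ i =
    (\<Sum>k<n. (if (i, k) \<in> parcs (circ n {p, q}) then 1 else 0) * v $ k)"
    using assms by (simp add: adj_mat_def scalar_prod_def atLeast0LessThan)
  also have "\<dots> = (\<Sum>k<n. if k \<in> ?f ` ?T then v $ k else 0)"
    by (intro sum.cong refl) (use circ_adjacent[OF assms(1) _ assms(2-4)] in auto)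
  also have "\<dots> = (\<Sum>k\<in>?f ` ?T. v $ k)"
    using assms by (subst sum.inter_filter[symmetric]) (auto simp: nat_less_iff intro!: sum.cong)
  also have "\<dots> = (\<Sum>t\<in>?T. v $ ?f t)"
  proof (subst sum.reindex)
    show "inj_on ?f ?T"
    proof (rule inj_onI)
      fix s t assume st: "s \<in> ?T" "t \<in> ?T" "?f s = ?f t"
      hence "(int i + s) mod int n = (int i + t) mod int n"
        using assms by (simp add: eq_nat_nat_iff)
      hence "int n dvd s - t" by (simp add: mod_eq_dvd_iff)
      \<comment> \<open>The largest difference is \<open>2 * q\<close>, between \<open>q\<close> and
        \<open>- q\<close>; so the four neighbours are distinct.\<close>
      moreover have "\<bar>s - t\<bar> < int n" using st assms by auto
      ultimately show "s = t"
        using zdvd_not_zless[of "\<bar>s - t\<bar>" "int n"] by auto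
    qed
  qed simp
  also have "\<dots> = (\<Sum>t\<in>?T. per n v (int i + t))" by (simp add: per_def)
  also have "\<dots> = per n v (int i + int p) + per n v (int i - int p) + per n v (int i + int q) + per n v (int i - int q)"
    using assms by (simp add: sum.insert_if)
  finally show ?thesis .
qed

lemma per_all_iff:
  assumes "n > 0" "\<And>x. P (x mod int n) \<longleftrightarrow> P x"
  shows "(\<forall>i<n. P (int i)) \<longleftrightarrow> (\<forall>x. P x)"
proof safe
  fix x assume *: "\<forall>i<n. P (int i)"
  have "nat (x mod int n) < n" using assms(1) by (simp add: nat_less_iff)
  hence "P (int (nat (x mod int n)))" using * by blast
  thus "P x" using assms by simp
qed auto

lemma in_null_space_circ:
  assumes "1 \<le> p" "p < q" "2 * q < n"
  shows "v \<in> null_space (circ n {p, q}) \<longleftrightarrow> v \<in> carrier_vec n \<and>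
    (\<forall>x. per n v (x + int p) + per n v (x - int p) + per n v (x + int q) + per n v (x - int q) = 0)"
    (is "_ \<longleftrightarrow> _ \<and> (\<forall>x. ?P x)")
proof -
  let ?A = "adj_mat (circ n {p, q})"
  have "v \<in> null_space (circ n {p, q}) \<longleftrightarrow> v \<in> carrier_vec n \<and> ?A *\<^sub>v v = 0\<^sub>v n"
    unfolding null_space_def by (simp add: mat_kernel[OF adj_mat_circ_carrier])
  also have "\<dots> \<longleftrightarrow> v \<in> carrier_vec n \<and> (\<forall>i<n. ?P (int i))"
    using carrier_matD[OF adj_mat_circ_carrier[of n "{p, q}"]] adj_mat_circ_mult_vec[OF _ assms]
    by (auto simp: vec_eq_iff simp del: index_mult_mat_vec)
  \<comment> \<open>The condition depends only on \<open>x mod int n\<close>, so the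
    \<open>n\<close> rows cover all integers.\<close>
  also have "(\<forall>i<n. ?P (int i)) \<longleftrightarrow> (\<forall>x. ?P x)"
    using assms by (intro per_all_iff) (simp_all add: per_def mod_simps)
  finally show ?thesis .
qed

text \<open>Replacing \<open>x\<close> by \<open>x + q\<close> turns the shifts \<open>p\<close>,
  \<open>- p\<close>, \<open>q\<close>, \<open>- q\<close> into \<open>p + q\<close>,
  \<open>q - p\<close>, \<open>(q - p) + (p + q)\<close>, \<open>0\<close>: the expanded product of
  the two factors.\<close>

lemma in_null_space_circ_factored:
  assumes "1 \<le> p" "p < q" "2 * q < n"
  shows "v \<in> null_space (circ n {p, q}) \<longleftrightarrow> v \<in> carrier_vec n \<and>
    (\<forall>x. (per n v x + per n v (x + int (p + q))) +
      (per n v (x + int (q - p)) + per n v (x + int (q - p) + int (p + q))) = 0)"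
    (is "_ \<longleftrightarrow> _ \<and> ?R")
proof -
  have "(\<forall>x. per n v (x + int p) + per n v (x - int p) + per n v (x + int q) + per n v (x - int q) = 0) \<longleftrightarrow>
    (\<forall>x. per n v (x + int q + int p) + per n v (x + int q - int p) + per n v (x + int q + int q)
      + per n v (x + int q - int q) = 0)" (is "?L \<longleftrightarrow> ?L'")
  proof
    assume l: ?L'
    show ?L
    proof
      fix x
      show "per n v (x + int p) + per n v (x - int p) + per n v (x + int q) + per n v (x - int q) = 0"
        using spec[OF l, of "x - int q"] by simp
    qed
  qed blast
  also have "\<dots> \<longleftrightarrow> ?R"
    using assms by (simp add: algebra_simps of_nat_diff)
  finally show ?thesis using in_null_space_circ[OF assms] by simp
qed

text \<open>The factors are removed one at a time: \<open>u\<close>, the image of \<open>v\<close>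
  under the factor for \<open>q - p\<close>, is antiperiodic under \<open>p + q\<close> and vanishes
  by \<open>z1\<close>; then \<open>v\<close> itself is antiperiodic under \<open>q - p\<close> and
  vanishes by \<open>z2\<close>.\<close>

lemma null_space_circ_eq_0:
  assumes pq: "1 \<le> p" "p < q" "2 * q < n"
    and v: "v \<in> null_space (circ n {p, q})"
    and z1: "\<And>i. i < antiperiod_dim n (p + q) \<Longrightarrow> per n v (int i) + per n v (int i + int (q - p)) = 0"
    and z2: "\<And>i. i < antiperiod_dim n (q - p) \<Longrightarrow> per n v (int i) = 0"
  shows "v = 0\<^sub>v n"
proof -
  have n: "n > 0" using pq by simp
  define u where "u x = per n v x + per n v (x + int (q - p))" for x
  have vc: "v \<in> carrier_vec n" and k: "u x + u (x + int (p + q)) = 0" for x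
    using v in_null_space_circ_factored[OF pq, of v] by (auto simp: u_def algebra_simps)
  have "u x = 0" for x
  proof (rule antiperiodic_eq_0[where w = u and a = "p + q", OF n])
    fix x show "u (x + int n) = u x"
      using per_add_period[of n v x] per_add_period[of n v "x + int (q - p)"]
      by (simp add: u_def algebra_simps)
    show "u (x + int (p + q)) = - u x" using k[of x] by simp
  qed (simp add: u_def z1)
  hence "per n v x = 0" for x
    by (intro antiperiodic_eq_0[where a = "q - p", OF n per_add_period _ z2])
      (simp_all add: u_def eq_neg_iff_add_eq_0 add.commute)
  thus ?thesis using vec_eq_0_iff_per[OF n vc] by simp
qed

lemma nullity_circ_le:
  assumes pq: "1 \<le> p" "p < q" "2 * q < n"
  shows "nullity (circ n {p, q}) \<le> antiperiod_dim n (p + q) + antiperiod_dim n (q - p)"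
proof -
  have n: "n > 0" using pq by simp
  let ?rs = "map (\<lambda>i. eval_vec n (int i) + eval_vec n (int i + int (q - p))) [0..<antiperiod_dim n (p + q)]
    @ map (\<lambda>i. eval_vec n (int i)) [0..<antiperiod_dim n (q - p)]"
  have "kernel_dim (adj_mat (circ n {p, q})) \<le> length ?rs"
  proof (rule kernel_dim_le_functionals[OF adj_mat_circ_carrier])
    fix v assume "v \<in> mat_kernel (adj_mat (circ n {p, q}))" and z: "\<forall>r\<in>set ?rs. r \<bullet> v = 0"
    hence v: "v \<in> null_space (circ n {p, q})" by (simp add: null_space_def)
    hence vc: "v \<in> carrier_vec n" using in_null_space_circ[OF pq] by simp
    show "v = 0\<^sub>v n"
      by (rule null_space_circ_eq_0[OF pq v])
        (use z in \<open>simp_all add: eval_vec_add_scalar_prod[OF n vc] eval_vec_scalar_prod[OF n vc] ball_Un\<close>)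
  qed auto
  thus ?thesis by (simp add: nullity_def)
qed

section \<open>Estimates of \<open>antiperiod_dim\<close>\<close>

lemma antiperiod_dim_odd: "odd n \<Longrightarrow> antiperiod_dim n a = 0"
  unfolding antiperiod_dim_def by (metis dvd_div_mult_self even_mult_iff gcd_dvd2)

text \<open>An even cofactor \<open>2 * f\<close> of \<open>d = gcd a (2 * m)\<close> gives
  \<open>m = d * f\<close>. If \<open>f = 1\<close>, then \<open>m\<close> divides \<open>a\<close>,
  but only \<open>m\<close> itself is a multiple of \<open>m\<close> strictly between
  \<open>0\<close> and \<open>2 * m\<close>; so \<open>f \<ge> 2\<close>.\<close>

lemma antiperiod_dim_le:
  assumes "0 < a" "a < 2 * m" "a \<noteq> m"
  shows "2 * antiperiod_dim (2 * m) a \<le> m"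
proof (cases "even (2 * m div gcd a (2 * m))")
  case True
  define d where "d = gcd a (2 * m)"
  obtain f where "2 * m div d = 2 * f" using True by (auto simp: d_def elim: evenE)
  hence m: "m = d * f"
    by (metis d_def dvd_mult_div_cancel gcd_dvd2 mult.left_commute mult_cancel1 numeral_neq_zero)
  have "f \<noteq> 1"
  proof
    assume "f = 1"
    hence "m dvd a" using m by (metis d_def gcd_dvd1 mult.right_neutral)
    then obtain c where c: "a = m * c" by (rule dvdE)
    have "c \<noteq> 0" using assms(1) c by (metis less_irrefl mult_0_right)
    moreover have "c \<noteq> 1" using assms(3) c by (metis mult.right_neutral)
    ultimately have "m * 2 \<le> m * c" by (intro mult_le_mono2) linarith
    thus False using assms(2) c by linarith
  qed
  moreover have "f \<noteq> 0" using m assms(1,2) by (metis mult_0_right not_less_zero)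
  ultimately have "d * 2 \<le> d * f" by (intro mult_le_mono2) linarith
  hence "2 * d \<le> m" using m by linarith
  thus ?thesis using True by (simp add: antiperiod_dim_def d_def)
qed (simp add: antiperiod_dim_def)

lemma antiperiod_dim_sum_less:
  assumes pq: "1 \<le> p" "p < q" "q < m" and ne: "p + q \<noteq> m" and gcd: "gcd (gcd p q) (2 * m) = 1"
  shows "antiperiod_dim (2 * m) (p + q) + antiperiod_dim (2 * m) (q - p) < m"
proof (rule ccontr)
  assume "\<not> ?thesis"
  moreover have "2 * antiperiod_dim (2 * m) (p + q) \<le> m" "2 * antiperiod_dim (2 * m) (q - p) \<le> m"
    using pq ne by (auto intro!: antiperiod_dim_le)
  ultimately have eq: "2 * antiperiod_dim (2 * m) (p + q) = m" "2 * antiperiod_dim (2 * m) (q - p) = m"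
    by linarith+
  define d where "d = gcd (p + q) (2 * m)"
  have d: "2 * d = m" "2 * gcd (q - p) (2 * m) = m"
    using eq pq unfolding antiperiod_dim_def d_def by (auto split: if_splits)
  hence "d dvd p + q" "d dvd q - p" "d dvd 2 * m"
    by (auto simp: d_def) (metis d(1) d_def gcd_dvd1 mult_cancel1 numeral_neq_zero)
  \<comment> \<open>The sum and difference are \<open>2 * q\<close> and \<open>2 * p\<close>.
    Doubling \<open>2 * m\<close> too lets a factor 2 be pulled out of the gcd, leaving
    \<open>d dvd 2\<close>.\<close>
  hence "d dvd (p + q) + (q - p)" "d dvd (p + q) - (q - p)" "d dvd 2 * (2 * m)"
    by (simp_all only: dvd_add dvd_diff_nat dvd_mult)
  moreover have "(p + q) + (q - p) = 2 * q" "(p + q) - (q - p) = 2 * p" using pq by simp_all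
  ultimately have "d dvd 2 * q" "d dvd 2 * p" "d dvd 2 * (2 * m)" by metis+
  hence "d dvd gcd (gcd (2 * p) (2 * q)) (2 * (2 * m))" by simp
  also have "\<dots> = 2" using gcd by (metis gcd_mult_distrib_nat mult.right_neutral)
  finally have "d = 1 \<or> d = 2" using prime_nat_iff two_is_prime_nat by blast
  thus False
  proof
    \<comment> \<open>For \<open>m = 4\<close> the pairs (1,2) and (2,3) have odd sum and (1,3) has
      sum \<open>m\<close>. The other case, \<open>d = 1\<close>, gives \<open>m = 2\<close>, with
      no room for \<open>1 \<le> p < q < m\<close>.\<close>
    assume "d = 2"
    hence "m = 4" "even (p + q)" using d \<open>d dvd p + q\<close> by auto
    moreover have "p \<in> {1,2}" "q \<in> {2,3}" using pq \<open>m = 4\<close> by auto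
    ultimately show False using ne pq by auto
  qed (use d pq in simp)
qed

section \<open>The case of steps adding up to half the order\<close>

text \<open>For \<open>p + q = m\<close> this is the image of \<open>v\<close> under the factor for
  \<open>p + q\<close>.\<close>

definition half_sum :: "nat \<Rightarrow> real vec \<Rightarrow> int \<Rightarrow> real" where
  "half_sum m v x = per (2 * m) v x + per (2 * m) v (x + int m)"

lemma half_sum_period: "half_sum m v (x + int m) = half_sum m v x"
  using per_add_period[of "2 * m" v x] by (simp add: half_sum_def algebra_simps)

lemma half_sum_int: "j < m \<Longrightarrow> half_sum m v (int j) = v $ j + v $ (j + m)"
  using per_int[of j "2 * m" v] per_int[of "j + m" "2 * m" v] by (simp add: half_sum_def)

lemma half_sum_all_eq_0:
  assumes "m > 0"
  shows "(\<forall>x. half_sum m v x = 0) \<longleftrightarrow> (\<forall>j<m. half_sum m v (int j) = 0)"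
proof -
  have "half_sum m v (x mod int m) = half_sum m v x" for x
    using period_multiple[of "half_sum m v" "int m" "x mod int m" "x div int m", OF half_sum_period] by simp
  thus ?thesis using per_all_iff[OF assms, of "\<lambda>x. half_sum m v x = 0"] by simp
qed

lemma in_null_space_circ_half:
  assumes "1 \<le> p" "p < q" "p + q = m"
  shows "v \<in> null_space (circ (2 * m) {p, q}) \<longleftrightarrow> v \<in> carrier_vec (2 * m) \<and>
    (\<forall>x. half_sum m v (x + int (q - p)) = - half_sum m v x)"
proof -
  have "half_sum m v (x + int (q - p)) = - half_sum m v x \<longleftrightarrow>
    (per (2 * m) v x + per (2 * m) v (x + int (p + q))) +
      (per (2 * m) v (x + int (q - p)) + per (2 * m) v (x + int (q - p) + int (p + q))) = 0" for x
    unfolding half_sum_def assms(3) by linarith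
  moreover have "2 * q < 2 * m" using assms by simp
  ultimately show ?thesis using in_null_space_circ_factored[OF assms(1,2)] by presburger
qed

text \<open>Since \<open>2 * p + (q - p) = m\<close> is a period, shifting by \<open>2 * p\<close>
  undoes a shift by \<open>q - p\<close>.\<close>

lemma antiperiodic_2p:
  fixes s :: "int \<Rightarrow> real"
  assumes "p < q" "p + q = m" and per: "\<And>x. s (x + int m) = s x"
    and anti: "\<And>x. s (x + int (q - p)) = - s x"
  shows "s (x + 2 * int p) = - s x"
proof -
  have "x + 2 * int p + int (q - p) = x + int m" using assms by auto
  thus ?thesis using anti[of "x + 2 * int p"] per[of x] by (metis minus_minus)
qed

text \<open>Some odd multiple of the antiperiod \<open>2 * p\<close> is a multiple of the period
  \<open>m\<close>, so \<open>s x = - s x\<close>.\<close>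

lemma half_antiperiodic_eq_0:
  fixes s :: "int \<Rightarrow> real"
  assumes "\<not> 4 dvd m" and per: "\<And>x. s (x + int m) = s x"
    and anti: "\<And>x. s (x + 2 * int p) = - s x"
  shows "s x = 0"
proof -
  \<comment> \<open>For \<open>m = 2 * h\<close> with \<open>h\<close> odd, \<open>e = h\<close> and
    \<open>k = p\<close>; for odd \<open>m\<close>, \<open>e = m\<close> and
    \<open>k = 2 * p\<close>.\<close>
  obtain e k where "odd e" "2 * p * e = k * m"
  proof (cases "even m")
    case True
    then obtain h where "m = 2 * h" by blast
    moreover from this have "odd h" using assms(1) by auto
    ultimately show ?thesis using that[of h p] by simp
  qed (use that[of m "2 * p"] in simp)
  hence "int e * (2 * int p) = int k * int m"
    by (metis mult.commute of_nat_mult of_nat_numeral)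
  hence "s (x + int e * (2 * int p)) = s x"
    using period_multiple[of s "int m", OF per] by simp
  thus ?thesis using shift_multiple[of s "2 * int p", OF anti] \<open>odd e\<close> by simp
qed

text \<open>Forward: Bezout gives \<open>k * p + l * m = 1\<close> with \<open>k\<close> odd because
  \<open>m\<close> is even, so \<open>2\<close> is an odd multiple of the antiperiod
  \<open>2 * p\<close> modulo \<open>m\<close>. Backward: \<open>q - p = m - 2 * p\<close> is an odd
  multiple of \<open>2\<close>.\<close>

lemma half_antiperiodic_iff:
  fixes s :: "int \<Rightarrow> real"
  assumes "4 dvd m" "p < q" "p + q = m" "coprime p m" and per: "\<And>x. s (x + int m) = s x"
  shows "(\<forall>x. s (x + int (q - p)) = - s x) \<longleftrightarrow> (\<forall>x. s (x + 2) = - s x)"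
proof
  have m: "even m" using assms(1) by (meson dvd_trans even_numeral)
  have p: "odd p" using assms(4) m by (meson coprime_common_divisor odd_one)
  {
    assume anti: "\<forall>x. s (x + int (q - p)) = - s x"
    obtain k l where "k * int p + l * int m = 1"
      using bezout_int[of "int p" "int m"] assms(4) by (auto simp: coprime_iff_gcd_eq_1)
    moreover from this m have "odd k" by (metis even_add even_mult_iff even_of_nat odd_one)
    show "\<forall>x. s (x + 2) = - s x"
    proof
      fix x
      have "x + 2 = x + k * (2 * int p) + 2 * l * int m"
        using \<open>k * int p + l * int m = 1\<close> by (simp add: algebra_simps)
      hence "s (x + 2) = s (x + k * (2 * int p))"
        using period_multiple[of s "int m", OF per] by metis
      also have "\<dots> = - s x"
        using shift_multiple[of s "2 * int p" x k] antiperiodic_2p[of p q m s] assms anti \<open>odd k\<close> by simp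
      finally show "s (x + 2) = - s x" .
    qed
  }
  assume anti: "\<forall>x. s (x + 2) = - s x"
  obtain g where g: "m = 4 * g" using assms(1) by blast
  have "int (q - p) = (2 * int g - int p) * 2" using assms g by auto
  thus "\<forall>x. s (x + int (q - p)) = - s x"
    using shift_multiple[of s 2 _ "2 * int g - int p"] anti p by simp
qed

lemma antiperiodic_2_explicit:
  fixes s :: "int \<Rightarrow> real"
  assumes "\<And>j. j + 2 < m \<Longrightarrow> s (int j + 2) = - s (int j)" "t + 2 * i < m"
  shows "s (int (t + 2 * i)) = (- 1) ^ i * s (int t)"
  using assms(2)
proof (induction i)
  case (Suc i)
  hence "s (int (t + 2 * i) + 2) = - s (int (t + 2 * i))" by (intro assms(1)) simp
  moreover have "int (t + 2 * Suc i) = int (t + 2 * i) + 2" by simp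
  ultimately have "s (int (t + 2 * Suc i)) = - s (int (t + 2 * i))" by metis
  also have "s (int (t + 2 * i)) = (- 1) ^ i * s (int t)" using Suc by simp
  finally show ?case by simp
qed simp

text \<open>Leaves only \<open>m - 2\<close> equations, which yields nullity at least
  \<open>m + 2\<close>; the two that wrap around follow from them.\<close>

lemma antiperiodic_2_iff:
  fixes s :: "int \<Rightarrow> real"
  assumes "4 dvd m" "m > 0" and per: "\<And>x. s (x + int m) = s x"
  shows "(\<forall>x. s (x + 2) = - s x) \<longleftrightarrow> (\<forall>j. j + 2 < m \<longrightarrow> s (int j + 2) = - s (int j))"
proof safe
  fix x assume fin: "\<forall>j. j + 2 < m \<longrightarrow> s (int j + 2) = - s (int j)"
  define j where "j = nat (x mod int m)"
  have j: "j < m" "int j = x mod int m" using assms(2) by (simp_all add: j_def nat_less_iff)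
  have red: "s (x + c) = s (int j + c)" for c
  proof -
    have "x + c = (int j + c) + (x div int m) * int m" by (simp add: j(2) algebra_simps)
    thus ?thesis using period_multiple[of s "int m", OF per] by metis
  qed
  obtain g where g: "m = 4 * g" "g > 0" using assms by auto
  show "s (x + 2) = - s x"
  proof (cases "j + 2 < m")
    case True
    then show ?thesis using fin red[of 2] red[of 0] by simp
  next
    case False
    \<comment> \<open>\<open>t\<close> is \<open>j + 2\<close> reduced modulo \<open>m\<close>. From
      \<open>t\<close> up to \<open>j\<close> there are \<open>2 * g - 1\<close> steps of length 2,
      an odd number, so the sign flips.\<close>
    define t where "t = j + 2 - m"
    have t: "j = t + 2 * (2 * g - 1)" "int j + 2 = int t + int m" using False g j(1) by (auto simp: t_def)
    have "s (int j) = (- 1) ^ (2 * g - 1) * s (int t)"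
      unfolding t(1) using fin t(1) j(1) by (intro antiperiodic_2_explicit[where m = m]) auto
    moreover have "odd (2 * g - 1)" using g by simp
    moreover have "s (int j + 2) = s (int t)" using t(2) per by simp
    ultimately show ?thesis using red[of 2] red[of 0] by simp
  qed
qed simp

lemma antiperiodic_2_eq_0:
  fixes s :: "int \<Rightarrow> real"
  assumes "\<And>x. s (x + 2) = - s x" "s 0 = 0" "s 1 = 0"
  shows "s x = 0"
proof -
  have "x = x mod 2 + (x div 2) * 2" by simp
  hence "\<bar>s x\<bar> = \<bar>s (x mod 2)\<bar>" using shift_multiple[of s 2 "x mod 2" "x div 2"] assms(1) by (metis abs_minus_cancel)
  moreover have "x mod 2 = 0 \<or> x mod 2 = 1" by auto
  ultimately show ?thesis using assms by auto
qed

lemma vec_eq_0_half_sum: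
  assumes m: "m > 0" and v: "v \<in> carrier_vec (2 * m)" and "\<And>x. half_sum m v x = 0"
    and "\<And>i. i < m \<Longrightarrow> per (2 * m) v (int i) = 0"
  shows "v = 0\<^sub>v (2 * m)"
proof -
  have "v $ i = 0" if "i < 2 * m" for i
  proof (cases "i < m")
    case True
    then show ?thesis using assms(4)[OF True] per_int[OF that, of v] by simp
  next
    case False
    have "half_sum m v (int (i - m)) = 0" "per (2 * m) v (int (i - m)) = 0"
      using that by (auto intro!: assms)
    thus ?thesis using False per_int[OF that, of v] by (simp add: half_sum_def of_nat_diff)
  qed
  thus ?thesis using v by (intro eq_vecI) auto
qed

section \<open>Null space and nullity of connected graphs with \<open>p + q = m\<close>\<close>

locale half_circulant =
  fixes p q m :: nat
  assumes pq: "1 \<le> p" "p < q" "p + q = m" and gcd: "gcd (gcd p q) (2 * m) = 1"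
begin

lemma m_pos: "2 * m > 0" "m > 0" using pq by auto

lemma coprime: "coprime p m"
proof (rule coprimeI)
  fix c assume "c dvd p" "c dvd m"
  moreover from this have "c dvd q" using pq(3) dvd_add_right_iff by blast
  ultimately have "c dvd gcd (gcd p q) (2 * m)" by simp
  thus "c dvd 1" using gcd by simp
qed

lemma null_space_not_4_dvd:
  assumes "\<not> 4 dvd m"
  shows "v \<in> null_space (circ (2 * m) {p, q}) \<longleftrightarrow>
    v \<in> carrier_vec (2 * m) \<and> (\<forall>x. half_sum m v x = 0)"
proof -
  have "half_sum m v x = 0" if h: "\<forall>x. half_sum m v (x + int (q - p)) = - half_sum m v x" for x
  proof (rule half_antiperiodic_eq_0[where s = "half_sum m v" and p = p, OF assms half_sum_period])
    show "half_sum m v (x + 2 * int p) = - half_sum m v x" for x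
      by (rule antiperiodic_2p[where s = "half_sum m v", OF pq(2,3) half_sum_period h[rule_format]])
  qed
  moreover have "half_sum m v (x + int (q - p)) = - half_sum m v x" if "\<forall>x. half_sum m v x = 0" for x
    using that by simp
  ultimately show ?thesis using in_null_space_circ_half[OF pq, of v] by blast
qed

lemma null_space_4_dvd:
  assumes "4 dvd m"
  shows "v \<in> null_space (circ (2 * m) {p, q}) \<longleftrightarrow>
    v \<in> carrier_vec (2 * m) \<and> (\<forall>x. half_sum m v (x + 2) = - half_sum m v x)"
  using in_null_space_circ_half[OF pq] half_antiperiodic_iff[where s = "half_sum m v", OF assms pq(2,3) coprime half_sum_period]
  by blast

text \<open>Upper bound: the first \<open>m\<close> entries determine a null vector, its second half
  being their negative. Lower bound: the \<open>m\<close> equations saying that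
  \<open>half_sum\<close> vanishes on \<open>0..m-1\<close> suffice.\<close>

lemma nullity_not_4_dvd:
  assumes "\<not> 4 dvd m"
  shows "nullity (circ (2 * m) {p, q}) = m"
proof (rule antisym)
  let ?A = "adj_mat (circ (2 * m) {p, q})"
  have "kernel_dim ?A \<le> length (map (\<lambda>i. eval_vec (2 * m) (int i)) [0..<m])"
  proof (rule kernel_dim_le_functionals[OF adj_mat_circ_carrier])
    fix v assume "v \<in> mat_kernel ?A"
      and *: "\<forall>r\<in>set (map (\<lambda>i. eval_vec (2 * m) (int i)) [0..<m]). r \<bullet> v = 0"
    hence v: "v \<in> carrier_vec (2 * m)" "\<And>x. half_sum m v x = 0"
      using null_space_not_4_dvd[OF assms] by (auto simp: null_space_def)
    show "v = 0\<^sub>v (2 * m)"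
      by (rule vec_eq_0_half_sum[OF m_pos(2) v])
        (use * in \<open>simp add: eval_vec_scalar_prod[OF m_pos(1) v(1)]\<close>)
  qed auto
  thus "nullity (circ (2 * m) {p, q}) \<le> m" by (simp add: nullity_def)
  let ?rs = "map (\<lambda>i. eval_vec (2 * m) (int i) + eval_vec (2 * m) (int i + int m)) [0..<m]"
  have "2 * m - length ?rs \<le> kernel_dim ?A"
  proof (rule kernel_dim_ge_functionals[OF adj_mat_circ_carrier])
    fix v :: "real vec" assume v: "v \<in> carrier_vec (2 * m)" and *: "\<forall>r\<in>set ?rs. r \<bullet> v = 0"
    have "\<forall>i<m. half_sum m v (int i) = 0"
      using * by (simp add: half_sum_def eval_vec_add_scalar_prod[OF m_pos(1) v])
    hence "\<forall>x. half_sum m v x = 0" using half_sum_all_eq_0[OF m_pos(2)] by simp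
    thus "v \<in> mat_kernel ?A" using null_space_not_4_dvd[OF assms] v by (simp add: null_space_def)
  qed auto
  thus "m \<le> nullity (circ (2 * m) {p, q})" by (simp add: nullity_def)
qed

text \<open>Upper bound: the first \<open>m + 2\<close> entries include those at \<open>0\<close>,
  \<open>1\<close>, \<open>m\<close>, \<open>m + 1\<close>; if they vanish, so does
  \<open>half_sum\<close> at \<open>0\<close> and \<open>1\<close>, hence everywhere. Lower bound:
  the \<open>m - 2\<close> equations of \<open>antiperiodic_2_iff\<close> suffice.\<close>

lemma nullity_4_dvd:
  assumes "4 dvd m"
  shows "nullity (circ (2 * m) {p, q}) = m + 2"
proof (rule antisym)
  let ?A = "adj_mat (circ (2 * m) {p, q})"
  have m4: "m \<ge> 4" using assms m_pos by (auto dest: dvd_imp_le)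
  let ?rs = "map (\<lambda>i. eval_vec (2 * m) (int i)) [0..<m + 2]"
  have "kernel_dim ?A \<le> length ?rs"
  proof (rule kernel_dim_le_functionals[OF adj_mat_circ_carrier])
    fix v assume "v \<in> mat_kernel ?A" and *: "\<forall>r\<in>set ?rs. r \<bullet> v = 0"
    hence v: "v \<in> carrier_vec (2 * m)" "\<And>x. half_sum m v (x + 2) = - half_sum m v x"
      using null_space_4_dvd[OF assms] by (auto simp: null_space_def)
    have z: "per (2 * m) v (int i) = 0" if "i < m + 2" for i
      using * that by (simp add: eval_vec_scalar_prod[OF m_pos(1) v(1)] del: upt_Suc)
    have "half_sum m v 0 = 0" "half_sum m v 1 = 0"
      using z[of 0] z[of 1] z[of m] z[of "m + 1"] m4 by (simp_all add: half_sum_def add.commute)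
    hence "half_sum m v x = 0" for x by (rule antiperiodic_2_eq_0[where s = "half_sum m v", OF v(2)])
    thus "v = 0\<^sub>v (2 * m)" using z by (intro vec_eq_0_half_sum[OF m_pos(2) v(1)]) auto
  qed auto
  thus "nullity (circ (2 * m) {p, q}) \<le> m + 2" by (simp add: nullity_def)
  let ?rs = "map (\<lambda>i. (eval_vec (2 * m) (int i) + eval_vec (2 * m) (int i + int m)) +
    (eval_vec (2 * m) (int i + 2) + eval_vec (2 * m) (int i + 2 + int m))) [0..<m - 2]"
  have "2 * m - length ?rs \<le> kernel_dim ?A"
  proof (rule kernel_dim_ge_functionals[OF adj_mat_circ_carrier])
    fix v :: "real vec" assume v: "v \<in> carrier_vec (2 * m)" and *: "\<forall>r\<in>set ?rs. r \<bullet> v = 0"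
    have "half_sum m v (int i + 2) = - half_sum m v (int i)" if "i + 2 < m" for i
    proof -
      have "half_sum m v (int i) + half_sum m v (int i + 2) = 0"
        using * that by (simp add: half_sum_def eval_vec_add_scalar_prod[OF m_pos(1) v]
          add_scalar_prod_distrib[of "_ + _" "2 * m"] v)
      thus ?thesis by simp
    qed
    hence "\<forall>x. half_sum m v (x + 2) = - half_sum m v x"
      using antiperiodic_2_iff[where s = "half_sum m v", OF assms m_pos(2) half_sum_period] by blast
    thus "v \<in> mat_kernel ?A" using null_space_4_dvd[OF assms] v by (simp add: null_space_def)
  qed auto
  thus "m + 2 \<le> nullity (circ (2 * m) {p, q})" using m4 by (simp add: nullity_def)
qed

end

section \<open>An explicit spanning set when \<open>4\<close> divides \<open>m\<close>\<close>

definition quarter_vec :: "nat \<Rightarrow> nat \<Rightarrow> real vec" where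
  "quarter_vec m t = finsum_vec TYPE(real) (2 * m)
     (\<lambda>j. (- 1) ^ j \<cdot>\<^sub>v unit_vec (2 * m) (m + 2 * j + t)) {0..<m div 2}"

lemma quarter_vec_carrier [simp]: "quarter_vec m t \<in> carrier_vec (2 * m)"
  unfolding quarter_vec_def by (rule finsum_vec_closed) auto

text \<open>Only the summand \<open>j = (i - m) div 2\<close> can contribute at index
  \<open>i\<close>; the clause \<open>m \<le> i\<close> guards against truncated
  subtraction.\<close>

lemma quarter_vec_index:
  assumes "i < 2 * m" "t < 2" "even m"
  shows "quarter_vec m t $ i = (if m \<le> i \<and> (i - m) mod 2 = t then (- 1) ^ ((i - m) div 2) else 0)"
proof -
  have "quarter_vec m t $ i =
    (\<Sum>j\<in>{0..<m div 2}. ((- 1) ^ j \<cdot>\<^sub>v unit_vec (2 * m) (m + 2 * j + t) :: real vec) $ i)"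
    unfolding quarter_vec_def using assms(1) by (intro index_finsum_vec) auto
  also have "\<dots> = (\<Sum>j\<in>{0..<m div 2}. if j = (i - m) div 2 then
      (if m \<le> i \<and> (i - m) mod 2 = t then (- 1) ^ ((i - m) div 2) else 0) else 0)"
  proof (rule sum.cong[OF refl])
    fix j assume j: "j \<in> {0..<m div 2}"
    have "i = m + 2 * j + t \<longleftrightarrow> j = (i - m) div 2 \<and> m \<le> i \<and> (i - m) mod 2 = t"
    proof
      assume "j = (i - m) div 2 \<and> m \<le> i \<and> (i - m) mod 2 = t"
      thus "i = m + 2 * j + t" using mult_div_mod_eq[of 2 "i - m"] by linarith
    qed (use assms(2) in simp)
    moreover have "m + 2 * j + t < 2 * m" using j assms(2,3) by auto
    ultimately show "((- 1) ^ j \<cdot>\<^sub>v unit_vec (2 * m) (m + 2 * j + t) :: real vec) $ i = (if j = (i - m) div 2 then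
      (if m \<le> i \<and> (i - m) mod 2 = t then (- 1) ^ ((i - m) div 2) else 0) else 0)"
      using assms(1) by (auto simp: unit_vec_def)
  qed
  also have "\<dots> = (if m \<le> i \<and> (i - m) mod 2 = t then (- 1) ^ ((i - m) div 2) else 0)"
    using assms(1,3) by (auto simp: sum.delta elim!: evenE)
  finally show ?thesis .
qed

text \<open>At \<open>0\<close> and \<open>1\<close> the half sums for \<open>t = 0\<close> and
  \<open>t = 1\<close> are (1,0) and (0,1), as needed to match the half sum of any null
  vector.\<close>

lemma half_sum_quarter_vec:
  assumes "j < m" "t < 2" "even m"
  shows "half_sum m (quarter_vec m t) (int j) = (if j mod 2 = t then (- 1) ^ (j div 2) else 0)"
  using assms by (simp add: half_sum_int quarter_vec_index)

text \<open>The partial sum over \<open>j < k\<close> of \<open>v $ j\<close> times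
  \<open>e_j - e_(m+j)\<close>, in closed form so that induction on \<open>k\<close> puts it into
  the span.\<close>

definition antisym_part :: "nat \<Rightarrow> real vec \<Rightarrow> nat \<Rightarrow> real vec" where
  "antisym_part m v k = vec (2 * m)
     (\<lambda>i. if i < k then v $ i else if m \<le> i \<and> i < m + k then - v $ (i - m) else 0)"

context half_circulant
begin

abbreviation (input) gens :: "real vec set" where
  "gens \<equiv> {unit_vec (2 * m) j - unit_vec (2 * m) (m + j) | j. j < m} \<union> {quarter_vec m 0, quarter_vec m 1}"

lemma null_space_4_dvd_finite:
  assumes "4 dvd m"
  shows "v \<in> null_space (circ (2 * m) {p, q}) \<longleftrightarrow> v \<in> carrier_vec (2 * m) \<and>
    (\<forall>j. j + 2 < m \<longrightarrow> half_sum m v (int (j + 2)) = - half_sum m v (int j))"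
  using null_space_4_dvd[OF assms, of v]
    antiperiodic_2_iff[where s = "half_sum m v", OF assms m_pos(2) half_sum_period]
  by (simp only: of_nat_add of_nat_numeral)

lemma gens_null_space:
  assumes "4 dvd m"
  shows "gens \<subseteq> null_space (circ (2 * m) {p, q})"
proof -
  have "even m" using assms by (meson dvd_trans even_numeral)
  hence "quarter_vec m t \<in> null_space (circ (2 * m) {p, q})" if "t < 2" for t
    using that unfolding null_space_4_dvd_finite[OF assms] by (auto simp: half_sum_quarter_vec simp del: of_nat_add of_nat_Suc)
  moreover have "unit_vec (2 * m) j - unit_vec (2 * m) (m + j) \<in> null_space (circ (2 * m) {p, q})"
    if "j < m" for j
    using that unfolding null_space_4_dvd_finite[OF assms] by (auto simp: half_sum_int simp del: of_nat_add of_nat_Suc)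
  ultimately show ?thesis by auto
qed

lemma null_space_eq_span:
  assumes "4 dvd m"
  shows "null_space (circ (2 * m) {p, q}) = span_vec (2 * m) gens"
proof
  interpret K: kernel "2 * m" "2 * m" "adj_mat (circ (2 * m) {p, q})"
    by unfold_locales (rule adj_mat_circ_carrier)
  have gK: "gens \<subseteq> mat_kernel (adj_mat (circ (2 * m) {p, q}))"
    using gens_null_space[OF assms] by (simp only: null_space_def)
  hence gc: "gens \<subseteq> carrier_vec (2 * m)"
    using mat_kernel_carrier[OF adj_mat_circ_carrier] by blast
  \<comment> \<open>The span taken inside the kernel equals the ambient span.\<close>
  show "span_vec (2 * m) gens \<subseteq> null_space (circ (2 * m) {p, q})"
    using K.span_same[OF gK] K.Ker.span_closed[OF gK] by (auto simp only: null_space_def)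
  show "null_space (circ (2 * m) {p, q}) \<subseteq> span_vec (2 * m) gens"
  proof
    fix v assume "v \<in> null_space (circ (2 * m) {p, q})"
    hence vc: "v \<in> carrier_vec (2 * m)"
      and v: "\<And>j. j + 2 < m \<Longrightarrow> half_sum m v (int j + 2) = - half_sum m v (int j)"
      using null_space_4_dvd[OF assms, of v] by auto
    have ev: "even m" using assms by (meson dvd_trans even_numeral)
    note add = K.NC.span_add1[unfolded module_vec_simps, OF gc]
    have anti: "antisym_part m v k \<in> span_vec (2 * m) gens" if "k \<le> m" for k
      using that
    proof (induction k)
      case 0
      have "antisym_part m v 0 = 0\<^sub>v (2 * m)" by (auto simp: antisym_part_def intro!: eq_vecI)
      thus ?case using vectorspace.span_zero[OF K.NC.vectorspace_axioms, of gens] by (simp add: module_vec_simps)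
    next
      case (Suc k)
      have "antisym_part m v (Suc k) =
        antisym_part m v k + v $ k \<cdot>\<^sub>v (unit_vec (2 * m) k - unit_vec (2 * m) (m + k))"
        using Suc.prems by (intro eq_vecI) (auto simp: antisym_part_def unit_vec_def less_Suc_eq)
      moreover have "unit_vec (2 * m) k - unit_vec (2 * m) (m + k) \<in> span_vec (2 * m) gens"
        using Suc.prems by (intro K.NC.span_mem[unfolded module_vec_simps, OF gc]) auto
      ultimately show ?case using Suc add K.NC.smult_in_span[OF gc] by simp
    qed
    let ?s = "half_sum m v"
    \<comment> \<open>Subtracting \<open>antisym_part m v m\<close> leaves zeros in the first half
      and \<open>?s j\<close> at \<open>m + j\<close>; \<open>?s j\<close> is
      \<open>?s (j mod 2)\<close> with sign \<open>(- 1) ^ (j div 2)\<close>, which is what the two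
      quarter vectors supply.\<close>
    have eq: "v = antisym_part m v m + (?s 0 \<cdot>\<^sub>v quarter_vec m 0 + ?s 1 \<cdot>\<^sub>v quarter_vec m 1)"
    proof (rule eq_vecI)
      fix i assume "i < dim_vec (antisym_part m v m + (?s 0 \<cdot>\<^sub>v quarter_vec m 0 + ?s 1 \<cdot>\<^sub>v quarter_vec m 1))"
      hence i: "i < 2 * m" by (simp add: carrier_vecD[OF quarter_vec_carrier])
      have idx: "(antisym_part m v m + (?s 0 \<cdot>\<^sub>v quarter_vec m 0 + ?s 1 \<cdot>\<^sub>v quarter_vec m 1)) $ i =
        antisym_part m v m $ i + (?s 0 * quarter_vec m 0 $ i + ?s 1 * quarter_vec m 1 $ i)"
        using i by (simp add: carrier_vecD[OF quarter_vec_carrier])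
      show "v $ i = (antisym_part m v m + (?s 0 \<cdot>\<^sub>v quarter_vec m 0 + ?s 1 \<cdot>\<^sub>v quarter_vec m 1)) $ i"
      proof (cases "i < m")
        case True
        then show ?thesis unfolding idx by (simp add: antisym_part_def quarter_vec_index[OF i] ev)
      next
        case False
        define j where "j = i - m"
        have j: "j < m" "i = j + m" using i False by (auto simp: j_def)
        have "?s (int (j mod 2 + 2 * (j div 2))) = (- 1) ^ (j div 2) * ?s (int (j mod 2))"
          using v j(1) by (intro antiperiodic_2_explicit[where m = m]) auto
        hence sum: "v $ j + v $ i = (- 1) ^ (j div 2) * ?s (int (j mod 2))"
          using half_sum_int[OF j(1), of v] j(2) by simp
        have quarter: "quarter_vec m t $ i = (if j mod 2 = t then (- 1) ^ (j div 2) else 0)"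
          if "t < 2" for t
          using quarter_vec_index[OF i that ev] j(2) by simp
        have anti_i: "antisym_part m v m $ i = - v $ j"
          using j by (simp add: antisym_part_def)
        show ?thesis
        proof (cases "j mod 2 = 0")
          case True
          hence "quarter_vec m 0 $ i = (- 1) ^ (j div 2)" "quarter_vec m 1 $ i = 0"
            using quarter[of 0] quarter[of 1] by simp_all
          moreover have "v $ j + v $ i = (- 1) ^ (j div 2) * ?s 0" using sum True by simp
          ultimately show ?thesis unfolding idx anti_i by (simp add: mult.commute)
        next
          case False
          hence "quarter_vec m 0 $ i = 0" "quarter_vec m 1 $ i = (- 1) ^ (j div 2)" "int (j mod 2) = 1"
            using quarter[of 0] quarter[of 1] by simp_all
          moreover have "v $ j + v $ i = (- 1) ^ (j div 2) * ?s 1" using sum calculation(3) by metis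
          ultimately show ?thesis unfolding idx anti_i by (simp add: mult.commute)
        qed
      qed
    qed (use vc in \<open>simp add: carrier_vecD[OF quarter_vec_carrier]\<close>)
    have "quarter_vec m 0 \<in> span_vec (2 * m) gens" "quarter_vec m 1 \<in> span_vec (2 * m) gens"
      by (intro K.NC.span_mem[unfolded module_vec_simps, OF gc]; simp)+
    from add[OF anti[OF order_refl] add[OF this[THEN K.NC.smult_in_span[OF gc]]]]
    show "v \<in> span_vec (2 * m) gens" by (rule ssubst[OF eq])
  qed
qed

end

section \<open>Connectedness\<close>

lemma circ_step:
  assumes "n > 0" "1 \<le> p" "p < q" "2 * q < n" "t \<in> {int p, - int p, int q, - int q}"
  shows "(nat (x mod int n), nat ((x + t) mod int n)) \<in> parcs (circ n {p, q})"
proof -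
  have "nat ((x + t) mod int n) = nat ((int (nat (x mod int n)) + t) mod int n)"
    using assms(1) by (simp add: mod_simps)
  thus ?thesis
    using assms by (subst circ_adjacent) (auto simp: nat_less_iff)
qed

lemma circ_steps:
  assumes "n > 0" "1 \<le> p" "p < q" "2 * q < n" "t \<in> {int p, - int p, int q, - int q}"
  shows "(nat (x mod int n), nat ((x + int k * t) mod int n)) \<in> (parcs (circ n {p, q}))\<^sup>*"
proof (induction k)
  case (Suc k)
  have "x + int (Suc k) * t = x + int k * t + t" by (simp add: algebra_simps)
  thus ?case using Suc circ_step[OF assms, of "x + int k * t"] by (metis rtrancl.rtrancl_into_rtrancl)
qed simp

lemma circ_steps_int:
  assumes "n > 0" "1 \<le> p" "p < q" "2 * q < n" "t \<in> {int p, int q}"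
  shows "(nat (x mod int n), nat ((x + k * t) mod int n)) \<in> (parcs (circ n {p, q}))\<^sup>*"
proof (cases "k \<ge> 0")
  case True
  then show ?thesis using circ_steps[OF assms(1-4), of t x "nat k"] assms(5) by auto
next
  case False
  then show ?thesis using circ_steps[OF assms(1-4), of "- t" x "nat (- k)"] assms(5) by auto
qed

text \<open>Two uses of Bezout write 1 as a combination of \<open>p\<close>, \<open>q\<close>,
  \<open>n\<close>. Scaling it by \<open>v - u\<close> says how many steps \<open>p\<close> and then
  \<open>q\<close> lead from \<open>u\<close> to \<open>v\<close> modulo \<open>n\<close>.\<close>

lemma circ_rtrancl:
  assumes n: "n > 0" and pq: "1 \<le> p" "p < q" "2 * q < n" and gcd: "gcd (gcd p q) n = 1"
    and "u < n" "v < n"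
  shows "(u, v) \<in> (parcs (circ n {p, q}))\<^sup>*"
proof -
  obtain a b where ab: "a * int p + b * int q = int (gcd p q)"
    using bezout_int[of "int p" "int q"] by auto
  obtain c d where cd: "c * int (gcd p q) + d * int n = 1"
    using bezout_int[of "int (gcd p q)" "int n"] gcd by auto
  define e where "e = int v - int u"
  have "int v = int u + e * (c * int (gcd p q) + d * int n)" by (simp add: cd e_def)
  also have "\<dots> = (int u + (e * c * a) * int p + (e * c * b) * int q) + (e * d) * int n"
    by (simp add: ab[symmetric] algebra_simps)
  finally have "int v mod int n = (int u + (e * c * a) * int p + (e * c * b) * int q) mod int n"
    by simp
  hence "v = nat ((int u + (e * c * a) * int p + (e * c * b) * int q) mod int n)"
    using assms by (metis mod_pos_pos_trivial nat_int of_nat_0_le_iff of_nat_less_iff)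
  moreover have "u = nat (int u mod int n)" using assms by simp
  ultimately show ?thesis
    using rtrancl_trans[OF circ_steps_int[OF n pq, of "int p" "int u" "e * c * a"]
      circ_steps_int[OF n pq, of "int q" "int u + (e * c * a) * int p" "e * c * b"]] by simp
qed

text \<open>Each arc changes the vertex by \<open>p\<close> or \<open>q\<close> up to sign, modulo
  \<open>n\<close>, so its residue modulo the gcd is invariant.\<close>

lemma circ_rtrancl_dvd:
  assumes "(u, v) \<in> (parcs (circ n {p, q}))\<^sup>*"
  shows "int (gcd (gcd p q) n) dvd int u - int v"
  using assms
proof (induction rule: rtrancl_induct)
  case (step y z)
  let ?d = "int (gcd (gcd p q) n)"
  have d: "?d dvd int p" "?d dvd int q" "?d dvd int n" by (meson dvd_trans gcd_dvd1 gcd_dvd2 of_nat_dvd_iff)+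
  obtain t where t: "t \<in> {int p, - int p, int q, - int q}" "int n dvd int y - int z - t"
    using step(2) by (auto simp: circ_def cong_iff_dvd_diff) (metis diff_minus_eq_add)+
  have "?d dvd (int y - int z - t) + t" using d t(1) dvd_trans[OF d(3) t(2)] by (intro dvd_add) auto
  hence "?d dvd (int u - int y) + (int y - int z)" using step.IH by (intro dvd_add) simp_all
  thus ?case by simp
qed simp

lemma connected_circ_iff:
  assumes pq: "1 \<le> p" "p < q" "2 * q < n"
  shows "Digraph_Component.connected (with_proj (circ n {p, q})) \<longleftrightarrow> gcd (gcd p q) n = 1"
proof -
  interpret pair_graph "circ n {p, q}" by (rule pair_graph_circ)
  have n: "n > 1" using pq by simp
  have verts: "pverts (circ n {p, q}) = {0..<n}" by (simp add: circ_def)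
  have sym: "symmetric (with_proj (circ n {p, q}))" by (rule sym_arcs)
  have "Digraph_Component.connected (with_proj (circ n {p, q})) \<longleftrightarrow>
    (\<forall>u<n. \<forall>v<n. (u, v) \<in> (parcs (circ n {p, q}))\<^sup>*)"
    \<comment> \<open>Connectedness is strong connectedness of the symmetric closure; the arcs are
      already symmetric.\<close>
    unfolding Digraph_Component.connected_def strongly_connected_def
    using n verts reachable_conv' by (auto simp: reachable_mk_symmetric_eq[OF sym])
  also have "\<dots> \<longleftrightarrow> gcd (gcd p q) n = 1"
  proof
    assume "\<forall>u<n. \<forall>v<n. (u, v) \<in> (parcs (circ n {p, q}))\<^sup>*"
    hence "int (gcd (gcd p q) n) dvd int 1 - int 0" using n by (intro circ_rtrancl_dvd) auto
    thus "gcd (gcd p q) n = 1" by simp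
  qed (use circ_rtrancl[OF _ pq] n in auto)
  finally show ?thesis .
qed

section \<open>Maximum nullity\<close>

text \<open>Membership may come from another pair of steps, but connectedness belongs to the graph,
  so the gcd test applies to the given pair.\<close>

lemma circ_mem_conn_quartic_circ:
  assumes pq: "1 \<le> p" "p < q" "2 * q < n"
  shows "circ n {p, q} \<in> conn_quartic_circ n \<longleftrightarrow> gcd (gcd p q) n = 1"
  using connected_circ_iff[OF pq] pq unfolding conn_quartic_circ_def by auto

lemma conn_quartic_circE:
  assumes "G \<in> conn_quartic_circ n"
  obtains p q where "G = circ n {p, q}" "1 \<le> p" "p < q" "2 * q < n" "gcd (gcd p q) n = 1"
  using assms connected_circ_iff unfolding conn_quartic_circ_def by blast

lemma max_nullity_eqI:
  assumes "G \<in> conn_quartic_circ n" "nullity G = N"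
    and "\<And>G. G \<in> conn_quartic_circ n \<Longrightarrow> nullity G \<le> N"
  shows "max_nullity n = N"
  unfolding max_nullity_def using assms by (intro Max_eqI) (auto simp: finite_conn_quartic_circ)

text \<open>For odd \<open>n\<close> both summands of the nullity bound are zero.\<close>

lemma circ_odd_order:
  assumes "n \<ge> 5" "odd n"
  shows "max_nullity n = 0"
    and "1 \<le> p \<Longrightarrow> p < q \<Longrightarrow> 2 * q < n \<Longrightarrow> attains_max n (circ n {p, q}) \<longleftrightarrow> gcd (gcd p q) n = 1"
    and "1 \<le> p \<Longrightarrow> p < q \<Longrightarrow> 2 * q < n \<Longrightarrow> null_space (circ n {p, q}) = {0\<^sub>v n}"
proof -
  have nul: "nullity (circ n {p, q}) = 0" if "1 \<le> p" "p < q" "2 * q < n" for p q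
    using nullity_circ_le[OF that] by (simp add: antiperiod_dim_odd[OF assms(2)])
  have "circ n {1, 2} \<in> conn_quartic_circ n" "nullity (circ n {1, 2}) = 0"
    using assms circ_mem_conn_quartic_circ[of 1 2 n] nul[of 1 2] by simp_all
  moreover have "nullity G \<le> 0" if "G \<in> conn_quartic_circ n" for G
    using that nul by (elim conn_quartic_circE) simp
  ultimately show max: "max_nullity n = 0" by (rule max_nullity_eqI)
  show "attains_max n (circ n {p, q}) \<longleftrightarrow> gcd (gcd p q) n = 1" if "1 \<le> p" "p < q" "2 * q < n"
    using circ_mem_conn_quartic_circ[OF that] nul[OF that] max by (simp add: attains_max_def)
  show "null_space (circ n {p, q}) = {0\<^sub>v n}" if pq: "1 \<le> p" "p < q" "2 * q < n"
  proof -
    have "v = 0\<^sub>v n" if "v \<in> null_space (circ n {p, q})" for v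
      using null_space_circ_eq_0[OF pq that] by (simp add: antiperiod_dim_odd[OF assms(2)])
    moreover have "per n (0\<^sub>v n) x = 0" for x
      using vec_eq_0_iff_per[of n "0\<^sub>v n"] pq by simp
    hence "0\<^sub>v n \<in> null_space (circ n {p, q})"
      using in_null_space_circ[OF pq] by simp
    ultimately show ?thesis by blast
  qed
qed

text \<open>Connected pairs with \<open>p + q = m\<close> all have nullity \<open>N\<close>, and the
  other connected pairs stay below \<open>m\<close>, hence below \<open>N\<close>.\<close>

lemma circ_even_order:
  assumes m: "m \<ge> 3"
  defines "N \<equiv> if 4 dvd m then m + 2 else m"
  shows "max_nullity (2 * m) = N"
    and "1 \<le> p \<Longrightarrow> p < q \<Longrightarrow> q < m \<Longrightarrow>
      attains_max (2 * m) (circ (2 * m) {p, q}) \<longleftrightarrow> p + q = m \<and> gcd (gcd p q) (2 * m) = 1"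
proof -
  have nul: "nullity (circ (2 * m) {p, q}) = N"
    if "1 \<le> p" "p < q" "p + q = m" "gcd (gcd p q) (2 * m) = 1" for p q
  proof -
    interpret half_circulant p q m by unfold_locales (use that in auto)
    show ?thesis using nullity_4_dvd nullity_not_4_dvd by (simp add: N_def)
  qed
  have less: "nullity (circ (2 * m) {p, q}) < N"
    if "1 \<le> p" "p < q" "q < m" "p + q \<noteq> m" "gcd (gcd p q) (2 * m) = 1" for p q
    using nullity_circ_le[of p q "2 * m"] antiperiod_dim_sum_less[OF that] that(1-3)
    by (auto simp: N_def)
  \<comment> \<open>A witness with sum \<open>m\<close> and gcd 1; \<open>m \<ge> 3\<close> ensures
    \<open>1 < m - 1\<close>.\<close>
  have "circ (2 * m) {1, m - 1} \<in> conn_quartic_circ (2 * m)" "nullity (circ (2 * m) {1, m - 1}) = N"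
    using m circ_mem_conn_quartic_circ[of 1 "m - 1" "2 * m"] nul[of 1 "m - 1"] by simp_all
  moreover have "nullity G \<le> N" if "G \<in> conn_quartic_circ (2 * m)" for G
    using that
  proof (rule conn_quartic_circE)
    fix p q assume "G = circ (2 * m) {p, q}" "1 \<le> p" "p < q" "2 * q < 2 * m" "gcd (gcd p q) (2 * m) = 1"
    thus "nullity G \<le> N" using nul[of p q] less[of p q] by (cases "p + q = m") simp_all
  qed
  ultimately show max: "max_nullity (2 * m) = N" by (rule max_nullity_eqI)
  show "attains_max (2 * m) (circ (2 * m) {p, q}) \<longleftrightarrow> p + q = m \<and> gcd (gcd p q) (2 * m) = 1"
    if "1 \<le> p" "p < q" "q < m"
    using circ_mem_conn_quartic_circ[of p q "2 * m"] nul[of p q] less[of p q] that max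
    unfolding attains_max_def by fastforce
qed

theorem theorem14:
  fixes n :: nat
  assumes "n \<ge> 5"
  shows
    "(odd n \<longrightarrow>
       max_nullity n = 0 \<and>
       (\<forall>p q. 1 \<le> p \<and> p < q \<and> 2 * q < n \<longrightarrow>
          (attains_max n (circ n {p, q}) \<longleftrightarrow> gcd (gcd p q) n = 1) \<and>
          (attains_max n (circ n {p, q}) \<longrightarrow> null_space (circ n {p, q}) = {0\<^sub>v n})))
     \<and>
     (n \<ge> 6 \<and> 2 dvd n \<and> \<not> 8 dvd n \<longrightarrow>
       max_nullity n = n div 2 \<and>
       (\<forall>p q. 1 \<le> p \<and> p < q \<and> 2 * q < n \<longrightarrow>
          (attains_max n (circ n {p, q}) \<longleftrightarrow> p + q = n div 2 \<and> gcd (gcd p q) n = 1) \<and>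
          (attains_max n (circ n {p, q}) \<longrightarrow>
             null_space (circ n {p, q}) =
               {v \<in> carrier_vec n. \<forall>j < n div 2. v $ (j + n div 2) = - (v $ j)})))
     \<and>
     (n \<ge> 8 \<and> 8 dvd n \<longrightarrow>
       max_nullity n = n div 2 + 2 \<and>
       (\<forall>p q. 1 \<le> p \<and> p < q \<and> 2 * q < n \<longrightarrow>
          (attains_max n (circ n {p, q}) \<longleftrightarrow> p + q = n div 2 \<and> gcd (gcd p q) n = 1) \<and>
          (attains_max n (circ n {p, q}) \<longrightarrow>
             null_space (circ n {p, q}) =
               span_vec n
                 ({unit_vec n j - unit_vec n (n div 2 + j) | j. j < n div 2} \<union>
                  {finsum_vec TYPE(real) n
                     (\<lambda>j. (- 1) ^ j \<cdot>\<^sub>v unit_vec n (n div 2 + 2 * j)) {0..<n div 4},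
                   finsum_vec TYPE(real) n
                     (\<lambda>j. (- 1) ^ j \<cdot>\<^sub>v unit_vec n (n div 2 + 2 * j + 1)) {0..<n div 4}}))))"
  (is "(odd n \<longrightarrow> ?odd) \<and> (?c2 \<longrightarrow> ?e2) \<and> (?c3 \<longrightarrow> ?e3)")
proof (intro conjI[where P = "odd n \<longrightarrow> _"] conjI[where P = "?c2 \<longrightarrow> _"] impI)
  assume "odd n"
  thus ?odd using circ_odd_order[OF assms] by simp
next
  assume c: "n \<ge> 6 \<and> 2 dvd n \<and> \<not> 8 dvd n"
  \<comment> \<open>In terms of \<open>m\<close>, divisibility of \<open>n\<close> by 8 is
    divisibility of \<open>m\<close> by 4.\<close>
  define m where "m = n div 2"
  have n: "n = 2 * m" "n div 2 = m" and m: "m \<ge> 3" "\<not> 4 dvd m"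
    using c by (auto simp: m_def)
  have "null_space (circ (2 * m) {p, q}) = {v \<in> carrier_vec (2 * m). \<forall>j<m. v $ (j + m) = - (v $ j)}"
    if "1 \<le> p" "p < q" "p + q = m" "gcd (gcd p q) (2 * m) = 1" for p q
  proof -
    interpret half_circulant p q m by unfold_locales (use that in auto)
    have "v $ j + v $ (j + m) = 0 \<longleftrightarrow> v $ (j + m) = - (v $ j)" for v :: "real vec" and j
      by linarith
    thus ?thesis
      by (auto simp: null_space_not_4_dvd[OF m(2)] half_sum_all_eq_0[OF m_pos(2)] half_sum_int)
  qed
  thus ?e2 unfolding n using circ_even_order[OF m(1)] m(2) by simp
next
  assume c: "n \<ge> 8 \<and> 8 dvd n"
  define m where "m = n div 2"
  have n: "n = 2 * m" "n div 2 = m" "n div 4 = m div 2" and m: "m \<ge> 3" "4 dvd m"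
    using c by (auto simp: m_def)
  have "null_space (circ (2 * m) {p, q}) = span_vec (2 * m)
      ({unit_vec (2 * m) j - unit_vec (2 * m) (m + j) | j. j < m} \<union> {quarter_vec m 0, quarter_vec m 1})"
    if "1 \<le> p" "p < q" "p + q = m" "gcd (gcd p q) (2 * m) = 1" for p q
  proof -
    interpret half_circulant p q m by unfold_locales (use that in auto)
    show ?thesis by (rule null_space_eq_span[OF m(2)])
  qed
  \<comment> \<open>Unfolding \<open>quarter_vec\<close> for \<open>t = 0\<close> and
    \<open>t = 1\<close> gives the two alternating sums, with \<open>m div 2\<close> in place of
    \<open>n div 4\<close>.\<close>
  thus ?e3 unfolding n using circ_even_order[OF m(1)] m(2) by (simp add: quarter_vec_def)
qed

end
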